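(* Let $R$ be an integral domain and $n\ge1$ an integer such that $O(R,n)=0$. Then $\omega(TD(R,n))=n$.
   Context: For a commutative ring $R$ with nonzero identity and an integer $n\ge1$, $TD(R,n)$ is the simple graph with vertex set $R^n\setminus\{(0,\ldots,0)\}$ in which two distinct vertices $\mathbf{x},\mathbf{y}$ are adjacent if and only if $\mathbf{x}\cdot\mathbf{y}=\sum_{i=1}^n x_iy_i=0$ in $R$. $O(R,n)$ denotes the number of non-trivial (i.e. nonzero) solutions $(x_1,\ldots,x_n)\in R^n$ of $x_1^2+\cdots+x_n^2=0$. $\omega(G)$ is the clique number of $G$ (largest size of a set of pairwise adjacent vertices). *)

theory Defs
  imports
    "Jordan_Normal_Form.Matrix"
    "HOL-Library.Extended_Nat"
    "HOL-Library.Ramsey"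
begin

text \<open>
  The ring \<open>R\<close> is a type of class \<^class>\<open>comm_ring_1\<close> (which includes \<open>0 \<noteq> 1\<close>), and \<open>R\<^sup>n\<close> is
  \<open>carrier_vec n\<close>. The ring may be infinite, so cardinalities are extended natural numbers:
  \<open>card\<close> alone would give an infinite set of solutions the cardinality \<open>0\<close>.
\<close>

definition ecard :: "'a set \<Rightarrow> enat" where
  "ecard A = (if finite A then enat (card A) else \<infinity>)"

record 'v sgraph =
  verts :: "'v set"
  edges :: "'v set set"

text \<open>
  The predicate \<^const>\<open>clique\<close> constrains only the pairs of distinct elements, so the inclusion in
  the vertex set is required separately. If the sizes of the cliques are bounded, the supremum is
  attained; otherwise the clique number is \<open>\<infinity>\<close>.
\<close>

definition clique_number :: "('v, 'm) sgraph_scheme \<Rightarrow> enat" where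
  "clique_number G = (SUP C \<in> {C. C \<subseteq> verts G \<and> clique C (edges G)}. ecard C)"

text \<open>The type argument names the ring.\<close>

definition TD :: "'a::comm_ring_1 itself \<Rightarrow> nat \<Rightarrow> 'a vec sgraph" where
  "TD R n =
    (let V = carrier_vec n - {0\<^sub>v n}
     in \<lparr> verts = V,
          edges = {{x, y} | x y. x \<in> V \<and> y \<in> V \<and> x \<noteq> y \<and> x \<bullet> y = 0} \<rparr>)"

definition num_nontrivial_solutions :: "'a::comm_ring_1 itself \<Rightarrow> nat \<Rightarrow> enat" where
  "num_nontrivial_solutions R n =
    ecard {x \<in> carrier_vec n. x \<noteq> (0\<^sub>v n :: 'a vec) \<and> (\<Sum>i<n. (x $ i)\<^sup>2) = 0}"

end

theory Submission
  imports Defs "Jordan_Normal_Form.Determinant"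
begin

text \<open>
  The standard basis vectors are pairwise orthogonal, so they form a clique of size \<open>n\<close>.

  Conversely, \<open>O(R,n) = 0\<close> says that no vertex is orthogonal to itself. If a clique had \<open>n + 1\<close>
  elements, pad each of them with a zero coordinate and let \<open>A\<close> be the square matrix with these
  rows. The Gram matrix \<open>A A\<^sup>T\<close> is diagonal with the nonzero entries \<open>v \<bullet> v\<close>, so \<open>(det A)\<^sup>2 \<noteq> 0\<close> in a
  domain, while \<open>A\<close> has a zero column, so \<open>det A = 0\<close>. Determinants thus replace linear
  independence over the field of fractions (\<open>card_orthogonal_anisotropic_le\<close>).
\<close>

text \<open>
  This is the usual fact that pairwise orthogonal vectors with \<open>v \<bullet> v \<noteq> 0\<close> are linearly
  independent, with the count of independent vectors expressed by a Gram determinant so that no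
  division is needed.
\<close>

lemma card_orthogonal_anisotropic_le:
  fixes S :: "'a::idom vec set"
  assumes fin: "finite S" and S: "S \<subseteq> carrier_vec n"
    and orth: "\<And>v w. v \<in> S \<Longrightarrow> w \<in> S \<Longrightarrow> v \<noteq> w \<Longrightarrow> v \<bullet> w = 0"
    and aniso: "\<And>v. v \<in> S \<Longrightarrow> v \<bullet> v \<noteq> 0"
  shows "card S \<le> n"
proof (rule ccontr)
  assume "\<not> card S \<le> n"
  then obtain T where T: "T \<subseteq> S" "card T = Suc n" "finite T"
    by (meson obtain_subset_with_card_n not_less_eq_eq)
  obtain vs where vs: "set vs = T" "distinct vs"
    using finite_distinct_list[OF T(3)] by blast
  have len: "length vs = Suc n"
    using T(2) vs distinct_card by metis
  have mem: "vs ! i \<in> S" if "i < Suc n" for i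
    using that len vs(1) T(1) nth_mem by fastforce
  \<comment> \<open>The padding column \<open>n\<close> makes \<open>A\<close> square and singular but does not change the inner products of
    the rows.\<close>
  define A where "A = mat (Suc n) (Suc n) (\<lambda>(i,j). if j < n then vs ! i $ j else 0)"
  have A: "A \<in> carrier_mat (Suc n) (Suc n)"
    by (simp add: A_def)
  have gram: "(A * A\<^sup>T) $$ (i,j) = vs ! i \<bullet> vs ! j" if "i < Suc n" "j < Suc n" for i j
  proof -
    have "dim_vec (vs ! j) = n"
      using mem[OF that(2)] S by auto
    then show ?thesis
      using that by (simp add: A_def scalar_prod_def)
  qed
  have offdiag: "(A * A\<^sup>T) $$ (i,j) = 0" if "i < Suc n" "j < Suc n" "i \<noteq> j" for i j
    using that gram orth mem vs(2) len by (simp add: nth_eq_iff_index_eq)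
  have "det A = 0"
  proof -
    have "det A = (\<Sum>i<Suc n. A $$ (i,n) * cofactor A i n)"
      using laplace_expansion_column[OF A, of n] by simp
    also have "\<dots> = 0"
      by (intro sum.neutral) (auto simp: A_def)
    finally show ?thesis .
  qed
  then have "det (A * A\<^sup>T) = 0"
    using det_mult[OF A, of "A\<^sup>T"] A by simp
  moreover have "det (A * A\<^sup>T) = prod_list (diag_mat (A * A\<^sup>T))"
    using A offdiag by (intro det_upper_triangular) auto
  moreover have "0 \<notin> set (diag_mat (A * A\<^sup>T))"
    using A gram aniso mem by (auto simp: diag_mat_def)
  ultimately show False
    by (simp add: prod_list_zero_iff)
qed

text \<open>Reduces a bound on all cliques, infinite ones included, to finite cliques.\<close>

lemma ecard_le_enatI:
  assumes "\<And>F. F \<subseteq> A \<Longrightarrow> finite F \<Longrightarrow> card F \<le> n"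
  shows "ecard A \<le> enat n"
proof (cases "finite A")
  case True
  then show ?thesis using assms[of A] by (simp add: ecard_def)
next
  case False
  then obtain F where "F \<subseteq> A" "finite F" "card F = Suc n"
    using infinite_arbitrarily_large by metis
  then show ?thesis using assms[of F] by simp
qed

lemma ecard_eq_0_iff: "ecard A = 0 \<longleftrightarrow> A = {}"
  by (auto simp: ecard_def zero_enat_def)

theorem theorem4p2:
  fixes n :: nat
  assumes "n \<ge> 1"
    and "num_nontrivial_solutions TYPE('a::idom) n = 0"
  shows "clique_number (TD TYPE('a) n) = enat n"
proof (rule antisym)
  have aniso: "v \<bullet> v \<noteq> 0" if "v \<in> carrier_vec n" "v \<noteq> 0\<^sub>v n" for v :: "'a vec"
    using assms(2) that
    by (auto simp: num_nontrivial_solutions_def ecard_eq_0_iff scalar_prod_def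
        power2_eq_square lessThan_atLeast0)
  show "clique_number (TD TYPE('a) n) \<le> enat n"
    unfolding clique_number_def
  proof (rule SUP_least)
    fix C assume "C \<in> {C. C \<subseteq> verts (TD TYPE('a) n) \<and> clique C (edges (TD TYPE('a) n))}"
    then have C: "C \<subseteq> carrier_vec n - {0\<^sub>v n}"
      and cl: "clique C (edges (TD TYPE('a) n))"
      by (auto simp: TD_def Let_def)
    have orth: "v \<bullet> w = 0" if vw: "v \<in> C" "w \<in> C" "v \<noteq> w" for v w
    proof -
      have "{v, w} \<in> edges (TD TYPE('a) n)"
        using cl vw by (auto simp: clique_def)
      then obtain x y where "{v, w} = {x, y}" "x \<in> carrier_vec n" "y \<in> carrier_vec n" "x \<bullet> y = 0"
        by (auto simp: TD_def Let_def)
      then show ?thesis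
        by (metis doubleton_eq_iff comm_scalar_prod)
    qed
    show "ecard C \<le> enat n"
    proof (rule ecard_le_enatI)
      fix F assume "F \<subseteq> C" "finite F"
      then show "card F \<le> n"
        using C orth aniso by (intro card_orthogonal_anisotropic_le) blast+
    qed
  qed
  let ?B = "unit_vec n ` {..<n} :: 'a vec set"
  have inj: "inj_on (unit_vec n :: nat \<Rightarrow> 'a vec) {..<n}"
    by (auto simp: inj_on_def)
  have nz: "(unit_vec n i :: 'a vec) \<noteq> 0\<^sub>v n" if "i < n" for i
    using that by simp
  have "?B \<subseteq> verts (TD TYPE('a) n)"
    using nz by (auto simp: TD_def Let_def)
  moreover have "clique ?B (edges (TD TYPE('a) n))"
    unfolding clique_def
  proof (intro ballI impI)
    fix v w :: "'a vec" assume vw: "v \<in> ?B" "w \<in> ?B" "v \<noteq> w"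
    then obtain i j where ij: "i < n" "j < n" "v = unit_vec n i" "w = unit_vec n j" "i \<noteq> j"
      by auto
    then have "v \<bullet> w = 0"
      by simp
    then show "{v, w} \<in> edges (TD TYPE('a) n)"
      using ij(1-4) vw(3) nz by (fastforce simp: TD_def Let_def)
  qed
  moreover have "ecard ?B = enat n"
    using inj by (simp add: ecard_def card_image)
  ultimately show "enat n \<le> clique_number (TD TYPE('a) n)"
    unfolding clique_number_def
    by (metis (mono_tags, lifting) SUP_upper mem_Collect_eq)
qed

end
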